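(* For any $A,B,B',C\in\widehat{\mathbb{F}_q}$, any $x\in\mathbb{F}_q$ and any $y\in\mathbb{F}_q\setminus\{1\}$, $$F_{2}(A;B,B';C,B';x,y)=-\varepsilon(y)\,\overline{A}(1-y)\,{}_{2}F_1\left(\begin{matrix}A,B\\ C\end{matrix}\bigg|\,\frac{x}{1-y}\right)+\overline{A}(-y)\,\overline{C}(x)\,\overline{B}C(1-x)$$ $$\qquad+\overline{A}(-y)\,\overline{C}(x)\,\overline{B}C(1-x)\left(-1+(q-1)\delta(A\overline{B'})\right)+\overline{B'}(y)\binom{A\overline{B'}}{\overline{B'}}\,{}_{2}F_1\left(\begin{matrix}A\overline{B'},B\\ C\end{matrix}\bigg|\,x\right).$$
   Context: Let $q$ be a power of a prime, $\mathbb{F}_q$ the field with $q$ elements, and $\widehat{\mathbb{F}_q}$ the group of (complex-valued) multiplicative characters of $\mathbb{F}_q^*$. Every character $\chi$, including the trivial character $\varepsilon$, is extended to $\mathbb{F}_q$ by $\chi(0)=0$. $\overline{\chi}$ denotes the inverse of $\chi$. Products of characters are evaluated pointwise, e.g. $\overline{B}C(1-x)=\overline{B}(1-x)C(1-x)$. For a character $\chi$, $\delta(\chi)=1$ if $\chi=\varepsilon$ and $\delta(\chi)=0$ otherwise. Jacobi sum: $J(\chi,\lambda)=\sum_{u\in\mathbb{F}_q}\chi(u)\lambda(1-u)$. Binomial coefficient of characters: $\binom{A}{B}=B(-1)J(A,\overline{B})$. Finite field ${}_2F_1$: for $A,B,C\in\widehat{\mathbb{F}_q}$ and $x\in\mathbb{F}_q$,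 $${}_{2}F_1\left(\begin{matrix}A,B\\ C\end{matrix}\bigg|\,x\right)=\varepsilon(x)\,BC(-1)\sum_{u\in\mathbb{F}_q}B(u)\,\overline{B}C(1-u)\,\overline{A}(1-xu).$$ The finite field Appell series $F_2$ is defined, for $A,B,B',C,C'\in\widehat{\mathbb{F}_q}$ and $x,y\in\mathbb{F}_q$, by $$F_{2}(A;B,B';C,C';x,y)=\varepsilon(xy)\,BB'CC'(-1)\sum_{u,v\in\mathbb{F}_q}B(u)B'(v)\,\overline{B}C(1-u)\,\overline{B'}C'(1-v)\,\overline{A}(1-ux-vy).$$ *)

theory Defs
  imports Complex_Main "HOL-Library.Cardinality"
begin

text \<open>
  The field with $q$ elements is a type of sort \<open>{field, finite}\<close>, with \<open>q = CARD('a)\<close>.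
  A multiplicative character is a homomorphism from the nonzero field elements to the
  nonzero complex numbers, extended by \<open>0\<close> at \<open>0\<close>; this includes the trivial character.
\<close>

definition mult_chars :: "('a::field \<Rightarrow> complex) set" where
  "mult_chars = {\<chi>. \<chi> 0 = 0 \<and> (\<forall>x. x \<noteq> 0 \<longrightarrow> \<chi> x \<noteq> 0) \<and>
     (\<forall>x y. x \<noteq> 0 \<longrightarrow> y \<noteq> 0 \<longrightarrow> \<chi> (x * y) = \<chi> x * \<chi> y)}"

definition triv_char :: "'a::field \<Rightarrow> complex" where
  "triv_char x = (if x = 0 then 0 else 1)"

definition char_mult :: "('a::field \<Rightarrow> complex) \<Rightarrow> ('a \<Rightarrow> complex) \<Rightarrow> 'a \<Rightarrow> complex"
    (infixl "\<odot>" 70) where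
  "(A \<odot> B) x = A x * B x"

text \<open>Since \<open>inverse 0 = 0\<close>, the pointwise inverse again vanishes at \<open>0\<close>.\<close>

definition char_inv :: "('a::field \<Rightarrow> complex) \<Rightarrow> 'a \<Rightarrow> complex" where
  "char_inv A x = inverse (A x)"

definition char_delta :: "('a::field \<Rightarrow> complex) \<Rightarrow> complex" where
  "char_delta A = (if A = triv_char then 1 else 0)"

lemma triv_char_in_mult_chars: "triv_char \<in> mult_chars"
  by (simp add: mult_chars_def triv_char_def)

lemma char_mult_in_mult_chars: "A \<in> mult_chars \<Longrightarrow> B \<in> mult_chars \<Longrightarrow> A \<odot> B \<in> mult_chars"
  by (simp add: mult_chars_def char_mult_def)

lemma char_inv_in_mult_chars: "A \<in> mult_chars \<Longrightarrow> char_inv A \<in> mult_chars"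
  by (simp add: mult_chars_def char_inv_def)

lemma char_mult_char_inv: "A \<in> mult_chars \<Longrightarrow> A \<odot> char_inv A = triv_char"
  by (auto simp: mult_chars_def char_mult_def char_inv_def triv_char_def)

definition jacobi_sum :: "('a::{field,finite} \<Rightarrow> complex) \<Rightarrow> ('a \<Rightarrow> complex) \<Rightarrow> complex" where
  "jacobi_sum A B = (\<Sum>u\<in>UNIV. A u * B (1 - u))"

definition char_binom :: "('a::{field,finite} \<Rightarrow> complex) \<Rightarrow> ('a \<Rightarrow> complex) \<Rightarrow> complex" where
  "char_binom A B = B (-1) * jacobi_sum A (char_inv B)"

definition hyp_2F1 ::
  "('a::{field,finite} \<Rightarrow> complex) \<Rightarrow> ('a \<Rightarrow> complex) \<Rightarrow> ('a \<Rightarrow> complex) \<Rightarrow> 'a \<Rightarrow> complex" where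
  "hyp_2F1 A B C x = triv_char x * (B \<odot> C) (-1) *
     (\<Sum>u\<in>UNIV. B u * (char_inv B \<odot> C) (1 - u) * char_inv A (1 - x * u))"

definition appell_F2 ::
  "('a::{field,finite} \<Rightarrow> complex) \<Rightarrow> ('a \<Rightarrow> complex) \<Rightarrow> ('a \<Rightarrow> complex) \<Rightarrow>
   ('a \<Rightarrow> complex) \<Rightarrow> ('a \<Rightarrow> complex) \<Rightarrow> 'a \<Rightarrow> 'a \<Rightarrow> complex" where
  "appell_F2 A B B' C C' x y = triv_char (x * y) * (B \<odot> B' \<odot> C \<odot> C') (-1) *
     (\<Sum>u\<in>UNIV. \<Sum>v\<in>UNIV. B u * B' v * (char_inv B \<odot> C) (1 - u) *
        (char_inv B' \<odot> C') (1 - v) * char_inv A (1 - u * x - v * y))"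

end

theory Submission
  imports Defs
begin

text \<open>
  Since \<open>\<epsilon>(1 - v)\<close> is the indicator of \<open>v \<noteq> 1\<close>, the inner sum over \<open>v\<close> is a complete twisted sum
  minus its term at \<open>v = 1\<close>, and that term yields the \<open>\<^sub>2F\<^sub>1\<close> at \<open>x / (1 - y)\<close>. The complete
  sum is homogeneous in \<open>w = 1 - u x\<close>: for \<open>w \<noteq> 0\<close> it rescales to a Jacobi sum and gives
  the \<open>\<^sub>2F\<^sub>1\<close> at \<open>x\<close>, while the single index \<open>u = 1 / x\<close> with \<open>w = 0\<close> gives an orthogonality
  sum and hence the terms without \<open>\<^sub>2F\<^sub>1\<close>.
\<close>

lemma mult_chars_zero: "\<chi> \<in> mult_chars \<Longrightarrow> \<chi> 0 = 0"
  by (simp add: mult_chars_def)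

lemma mult_chars_eq_0_iff: "\<chi> \<in> mult_chars \<Longrightarrow> \<chi> x = 0 \<longleftrightarrow> x = 0"
  by (auto simp: mult_chars_def)

text \<open>If a factor is 0, both sides are 0, so the substitutions below can pull factors out of a
  character without splitting off 0.\<close>

lemma mult_chars_mult: "\<chi> \<in> mult_chars \<Longrightarrow> \<chi> (x * y) = \<chi> x * \<chi> y"
  by (cases "x = 0 \<or> y = 0") (auto simp: mult_chars_def)

lemma mult_chars_one:
  assumes "\<chi> \<in> mult_chars"
  shows "\<chi> 1 = 1"
  using mult_chars_mult[OF assms, of 1 1] mult_chars_eq_0_iff[OF assms, of 1] by simp

lemma mult_chars_inverse:
  assumes "\<chi> \<in> mult_chars"
  shows "\<chi> (inverse x) = inverse (\<chi> x)"
proof (cases "x = 0")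
  case False
  then have "\<chi> (inverse x) * \<chi> x = 1"
    using mult_chars_mult[OF assms, of "inverse x" x] mult_chars_one[OF assms] by simp
  then show ?thesis
    by (metis inverse_unique mult.commute)
qed (simp add: mult_chars_zero[OF assms])

lemma mult_chars_divide: "\<chi> \<in> mult_chars \<Longrightarrow> \<chi> (x / y) = \<chi> x / \<chi> y"
  using mult_chars_mult[of \<chi> x "inverse y"] mult_chars_inverse[of \<chi> y]
  by (simp add: divide_inverse)

lemma mult_chars_minus_one_square: "\<chi> \<in> mult_chars \<Longrightarrow> \<chi> (-1) * \<chi> (-1) = 1"
  using mult_chars_mult[of \<chi> "-1" "-1"] mult_chars_one[of \<chi>] by simp

lemma char_mult_char_inv_eq_triv_char_iff:
  assumes "A \<in> mult_chars" "B \<in> mult_chars"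
  shows "A \<odot> char_inv B = triv_char \<longleftrightarrow> A = B"
proof
  assume *: "A \<odot> char_inv B = triv_char"
  show "A = B"
  proof
    fix x
    show "A x = B x"
      using fun_cong[OF *, of x] mult_chars_eq_0_iff[OF assms(2), of x]
        mult_chars_zero[OF assms(1)] mult_chars_zero[OF assms(2)]
      by (cases "x = 0") (auto simp: char_mult_def char_inv_def triv_char_def field_simps)
  qed
qed (use char_mult_char_inv[OF assms(2)] in auto)

text \<open>Orthogonality: scaling by \<open>a\<close> permutes the field, so the sum equals
  \<open>\<chi> a\<close> times itself; a nontrivial \<open>\<chi>\<close> has a nonzero
  \<open>a\<close> with \<open>\<chi> a \<noteq> 1\<close>.\<close>

lemma sum_mult_chars:
  fixes \<chi> :: "'a::{field,finite} \<Rightarrow> complex"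
  assumes "\<chi> \<in> mult_chars"
  shows "(\<Sum>x\<in>UNIV. \<chi> x) = (of_nat CARD('a) - 1) * char_delta \<chi>"
proof (cases "\<chi> = triv_char")
  case True
  have "(\<Sum>x\<in>UNIV. triv_char (x :: 'a)) = (\<Sum>x\<in>UNIV - {0::'a}. 1 :: complex)"
    by (rule sum.mono_neutral_cong_right) (auto simp: triv_char_def)
  then show ?thesis
    using True by (simp add: char_delta_def card_Diff_singleton of_nat_diff Suc_leI)
next
  case False
  then obtain a where a: "\<chi> a \<noteq> triv_char a"
    by auto
  with assms have [simp]: "a \<noteq> 0"
    by (auto simp: triv_char_def mult_chars_zero[OF assms])
  have "(\<Sum>x\<in>UNIV. \<chi> x) = (\<Sum>x\<in>UNIV. \<chi> (a * x))"
    by (rule sum.reindex_bij_witness[of _ "\<lambda>x. a * x" "\<lambda>x. x / a"]) auto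
  also have "\<dots> = \<chi> a * (\<Sum>x\<in>UNIV. \<chi> x)"
    by (simp add: mult_chars_mult[OF assms] sum_distrib_left)
  finally have "(\<Sum>x\<in>UNIV. \<chi> x) = 0"
    using a by (simp add: triv_char_def)
  with False show ?thesis
    by (simp add: char_delta_def)
qed

text \<open>The substitution \<open>s = 1 - 1 / u\<close> links the binomial coefficient of the
  theorem to the Jacobi sum that rescaling produces.\<close>

lemma char_binom_char_inv:
  assumes "A \<in> mult_chars" "B \<in> mult_chars"
  shows "char_binom (A \<odot> char_inv B) (char_inv B) = jacobi_sum B (char_inv A)"
proof -
  have m: "B (-1) \<noteq> 0" "inverse (B (-1)) = B (-1)"
    using mult_chars_minus_one_square[OF assms(2)] mult_chars_eq_0_iff[OF assms(2), of "-1"]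
      mult_chars_inverse[OF assms(2), of "-1"] by auto
  have "char_binom (A \<odot> char_inv B) (char_inv B) =
      (\<Sum>u\<in>UNIV. B (-1) * (A u * inverse (B u) * B (1 - u)))"
    using m by (simp add: char_binom_def jacobi_sum_def char_mult_def char_inv_def sum_distrib_left)
  also have "\<dots> = (\<Sum>u\<in>UNIV - {0}. B (-1) * (A u * inverse (B u) * B (1 - u)))"
    by (rule sum.mono_neutral_right) (auto simp: mult_chars_zero[OF assms(1)])
  \<comment> \<open>The map \<open>1 - 1 / u\<close> takes the nonzero elements bijectively onto the
    elements other than 1; the missing term \<open>s = 1\<close> is 0.\<close>
  also have "\<dots> = (\<Sum>s\<in>UNIV - {1}. B s * char_inv A (1 - s))"
  proof (rule sum.reindex_bij_witness[of _ "\<lambda>s. 1 / (1 - s)" "\<lambda>u. 1 - 1 / u"])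
    fix u :: 'a
    assume u: "u \<in> UNIV - {0}"
    \<comment> \<open>The sign here absorbs the factor \<open>B (-1)\<close> of the binomial
      coefficient.\<close>
    then have "1 - 1 / u = (-1) * (1 - u) / u"
      by (simp add: field_simps)
    then have "B (1 - 1 / u) = B (-1) * B (1 - u) / B u"
      by (simp only: mult_chars_mult[OF assms(2)] mult_chars_divide[OF assms(2)])
    then show "B (1 - 1 / u) * char_inv A (1 - (1 - 1 / u)) =
        B (-1) * (A u * inverse (B u) * B (1 - u))"
      using mult_chars_inverse[OF assms(1), of u]
      by (simp add: char_inv_def divide_inverse mult_ac)
  qed auto
  also have "\<dots> = jacobi_sum B (char_inv A)"
    unfolding jacobi_sum_def
    by (rule sum.mono_neutral_left) (auto simp: char_inv_def mult_chars_zero[OF assms(1)])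
  finally show ?thesis .
qed

text \<open>Substituting \<open>v = w * s / y\<close> gives \<open>w - v * y = w * (1 - s)\<close>,
  so all dependence on \<open>w\<close> and \<open>y\<close> factors out.\<close>

lemma sum_char_affine_nonzero:
  assumes "A \<in> mult_chars" "B \<in> mult_chars" "y \<noteq> 0" "w \<noteq> 0"
  shows "(\<Sum>v\<in>UNIV. B v * char_inv A (w - v * y)) =
    char_inv (A \<odot> char_inv B) w * char_inv B y * jacobi_sum B (char_inv A)"
proof -
  have "(\<Sum>v\<in>UNIV. B v * char_inv A (w - v * y)) =
      (\<Sum>s\<in>UNIV. B (w * s / y) * char_inv A (w * (1 - s)))"
    by (rule sum.reindex_bij_witness[of _ "\<lambda>s. w * s / y" "\<lambda>v. v * y / w"])
      (use assms in \<open>auto simp: right_diff_distrib\<close>)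
  also have "\<dots> = (\<Sum>s\<in>UNIV. char_inv (A \<odot> char_inv B) w * char_inv B y * (B s * char_inv A (1 - s)))"
    by (intro sum.cong)
      (simp_all add: mult_chars_mult[OF assms(1)] mult_chars_mult[OF assms(2)]
        mult_chars_inverse[OF assms(2)] char_inv_def char_mult_def divide_inverse mult_ac)
  finally show ?thesis
    by (simp add: jacobi_sum_def sum_distrib_left)
qed

text \<open>The degenerate case \<open>w = 0\<close>, where rescaling by \<open>w\<close> is
  impossible: the summand is a constant times \<open>(B \<odot> char_inv A) v\<close>, and
  orthogonality applies.\<close>

lemma sum_char_affine_zero:
  fixes A B :: "'a::{field,finite} \<Rightarrow> complex"
  assumes "A \<in> mult_chars" "B \<in> mult_chars"
  shows "(\<Sum>v\<in>UNIV. B v * char_inv A (- (v * y))) =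
    char_inv A (- y) * ((of_nat CARD('a) - 1) * char_delta (A \<odot> char_inv B))"
proof -
  have "char_inv A (- (v * y)) = char_inv A (- y) * char_inv A v" for v
    using mult_chars_mult[OF assms(1), of "- y" v] by (simp add: char_inv_def mult.commute)
  then have "(\<Sum>v\<in>UNIV. B v * char_inv A (- (v * y))) =
      char_inv A (- y) * (\<Sum>v\<in>UNIV. (B \<odot> char_inv A) v)"
    by (simp add: sum_distrib_left char_mult_def mult_ac)
  \<comment> \<open>Both deltas test whether \<open>A = B\<close>.\<close>
  moreover have "char_delta (B \<odot> char_inv A) = char_delta (A \<odot> char_inv B)"
    using char_mult_char_inv_eq_triv_char_iff[OF assms]
      char_mult_char_inv_eq_triv_char_iff[OF assms(2,1)] by (auto simp: char_delta_def)
  ultimately show ?thesis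
    using sum_mult_chars[OF char_mult_in_mult_chars[OF assms(2) char_inv_in_mult_chars[OF assms(1)]]]
    by simp
qed

text \<open>The Jacobi term carries no case distinction because it vanishes by itself at
  \<open>w = 0\<close>. The last term is the deleted summand \<open>v = 1\<close>.\<close>

lemma sum_char_affine:
  fixes A B :: "'a::{field,finite} \<Rightarrow> complex"
  assumes "A \<in> mult_chars" "B \<in> mult_chars" "y \<noteq> 0"
  shows "(\<Sum>v\<in>UNIV. B v * (char_inv B \<odot> B) (1 - v) * char_inv A (w - v * y)) =
    char_inv (A \<odot> char_inv B) w * char_inv B y * jacobi_sum B (char_inv A) +
    (if w = 0 then char_inv A (- y) * ((of_nat CARD('a) - 1) * char_delta (A \<odot> char_inv B)) else 0) -
    char_inv A (w - y)"
proof -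
  let ?f = "\<lambda>v. B v * char_inv A (w - v * y)"
  have "(\<Sum>v\<in>UNIV. B v * (char_inv B \<odot> B) (1 - v) * char_inv A (w - v * y)) = sum ?f (UNIV - {1})"
    by (rule sum.mono_neutral_cong_right)
      (auto simp: char_mult_def char_inv_def mult_chars_eq_0_iff[OF assms(2)])
  also have "\<dots> = sum ?f UNIV - char_inv A (w - y)"
    by (simp add: sum_diff1 mult_chars_one[OF assms(2)])
  finally show ?thesis
    using assms sum_char_affine_nonzero[of A B y w] sum_char_affine_zero[of A B y]
    by (cases "w = 0") (auto simp: char_inv_def char_mult_def mult_chars_zero[OF assms(1)])
qed

theorem theorem3p3:
  fixes A B B' C :: "'a::{field,finite} \<Rightarrow> complex" and x y :: 'a
  assumes "A \<in> mult_chars" and "B \<in> mult_chars" and "B' \<in> mult_chars" and "C \<in> mult_chars"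
    and "y \<noteq> 1"
  shows "appell_F2 A B B' C B' x y =
      - triv_char y * char_inv A (1 - y) * hyp_2F1 A B C (x / (1 - y))
      + char_inv A (- y) * char_inv C x * (char_inv B \<odot> C) (1 - x)
      + char_inv A (- y) * char_inv C x * (char_inv B \<odot> C) (1 - x) *
          (- 1 + (of_nat CARD('a) - 1) * char_delta (A \<odot> char_inv B'))
      + char_inv B' y * char_binom (A \<odot> char_inv B') (char_inv B') *
          hyp_2F1 (A \<odot> char_inv B') B C x"
proof (cases "x = 0 \<or> y = 0")
  \<comment> \<open>Every term vanishes: for \<open>x = 0\<close> through \<open>triv_char\<close>
    or \<open>char_inv C x\<close>, for \<open>y = 0\<close> through \<open>triv_char y\<close>,
    \<open>char_inv A (- y)\<close> or \<open>char_inv B' y\<close>.\<close>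
  case True
  then show ?thesis
    by (auto simp: appell_F2_def hyp_2F1_def triv_char_def char_inv_def
        mult_chars_zero[OF assms(1)] mult_chars_zero[OF assms(3)] mult_chars_zero[OF assms(4)])
next
  case False
  then have x: "x \<noteq> 0" and y: "y \<noteq> 0" and y1: "1 - y \<noteq> 0"
    using assms by auto
  note chars = assms(1-4)
  let ?q = "(of_nat CARD('a) - 1) * char_delta (A \<odot> char_inv B')"
  let ?J = "jacobi_sum B' (char_inv A)"
  let ?BC = "(B \<odot> C) (-1)"
  let ?g = "\<lambda>u. B u * (char_inv B \<odot> C) (1 - u)"
  have "(B \<odot> B' \<odot> C \<odot> B') (-1) = ?BC"
    using mult_chars_minus_one_square[OF assms(3)] by (simp add: char_mult_def)
  then have "appell_F2 A B B' C B' x y = ?BC * (\<Sum>u\<in>UNIV. \<Sum>v\<in>UNIV.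
      ?g u * (B' v * (char_inv B' \<odot> B') (1 - v) * char_inv A (1 - u * x - v * y)))"
    using x y by (simp add: appell_F2_def triv_char_def mult_ac)
  \<comment> \<open>The factor \<open>?g u\<close> is free of \<open>v\<close>; the inner sum is
    evaluated with \<open>w = 1 - u * x\<close>.\<close>
  also have "\<dots> = ?BC * (\<Sum>u\<in>UNIV. ?g u *
      (char_inv (A \<odot> char_inv B') (1 - u * x) * char_inv B' y * ?J +
       (if 1 - u * x = 0 then char_inv A (- y) * ?q else 0) - char_inv A (1 - u * x - y)))"
    by (simp only: sum_distrib_left[symmetric] sum_char_affine[OF chars(1,3) y])
  also have "\<dots> = char_inv B' y * ?J *
        (?BC * (\<Sum>u\<in>UNIV. ?g u * char_inv (A \<odot> char_inv B') (1 - u * x)))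
      + ?BC * (\<Sum>u\<in>UNIV. if 1 - u * x = 0 then ?g u * (char_inv A (- y) * ?q) else 0)
      - ?BC * (\<Sum>u\<in>UNIV. ?g u * char_inv A (1 - u * x - y))"
    by (simp add: algebra_simps sum.distrib sum_subtractf sum_distrib_left if_distrib[of "\<lambda>t. _ * t"]
        cong: if_cong)
  also have "?BC * (\<Sum>u\<in>UNIV. ?g u * char_inv (A \<odot> char_inv B') (1 - u * x)) =
      hyp_2F1 (A \<odot> char_inv B') B C x"
    using x by (simp add: hyp_2F1_def triv_char_def mult.commute)
  also have "?BC * (\<Sum>u\<in>UNIV. if 1 - u * x = 0 then ?g u * (char_inv A (- y) * ?q) else 0) =
      char_inv A (- y) * char_inv C x * (char_inv B \<odot> C) (1 - x) * ?q"
  proof -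
    have "1 - u * x = 0 \<longleftrightarrow> u = 1 / x" for u
      using x by (auto simp: field_simps)
    then have "(\<Sum>u\<in>UNIV. if 1 - u * x = 0 then ?g u * (char_inv A (- y) * ?q) else 0) =
        ?g (1 / x) * (char_inv A (- y) * ?q)"
      by simp
    moreover have "?BC * ?g (1 / x) = char_inv C x * (char_inv B \<odot> C) (1 - x)"
    proof -
      have "1 - 1 / x = (-1) * (1 - x) / x"
        using x by (simp add: field_simps)
      then have split: "\<chi> (1 - 1 / x) = \<chi> (-1) * \<chi> (1 - x) / \<chi> x"
        if "\<chi> \<in> mult_chars" for \<chi> :: "'a \<Rightarrow> complex"
        using that by (simp only: mult_chars_mult mult_chars_divide)
      \<comment> \<open>Only \<open>B (-1)\<close> and \<open>B x\<close> get cancelled. The factor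
        from \<open>1 - x\<close> stays inverted on both sides, so \<open>x = 1\<close> is
        covered.\<close>
      have "B (-1) \<noteq> 0" "B x \<noteq> 0"
        using x by (simp_all add: mult_chars_eq_0_iff[OF chars(2)])
      then have "?BC * ?g (1 / x) = C (-1) * C (-1) * (char_inv C x * (char_inv B \<odot> C) (1 - x))"
        using split[OF chars(2)] split[OF chars(4)] mult_chars_divide[OF chars(2), of 1 x]
          mult_chars_one[OF chars(2)]
        by (simp add: char_mult_def char_inv_def divide_inverse) (simp add: field_simps)
      then show ?thesis
        using mult_chars_minus_one_square[OF chars(4)] by simp
    qed
    ultimately show ?thesis
      by (simp add: mult_ac)
  qed
  also have "?BC * (\<Sum>u\<in>UNIV. ?g u * char_inv A (1 - u * x - y)) =
      char_inv A (1 - y) * hyp_2F1 A B C (x / (1 - y))"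
  proof -
    \<comment> \<open>Taking out \<open>1 - y\<close>, nonzero by hypothesis, makes
      \<open>x / (1 - y)\<close> the new argument; it is nonzero, so its \<open>triv_char\<close>
      value is 1.\<close>
    have "1 - u * x - y = (1 - y) * (1 - x / (1 - y) * u)" for u
      using y1 by (simp add: right_diff_distrib mult.commute)
    then have "char_inv A (1 - u * x - y) = char_inv A (1 - y) * char_inv A (1 - x / (1 - y) * u)" for u
      by (simp only: char_inv_def mult_chars_mult[OF chars(1)] inverse_mult_distrib)
    then show ?thesis
      using x y1 by (simp add: hyp_2F1_def triv_char_def sum_distrib_left mult_ac)
  qed
  finally show ?thesis
    \<comment> \<open>The two terms without \<open>hyp_2F1\<close> in the statement add up to the
      single one found here, since the \<open>- 1\<close> cancels the first of them.\<close>
    using y by (simp add: char_binom_char_inv[OF chars(1,3)] triv_char_def algebra_simps)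
qed

end
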